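(* Let $f\colon P\twoheadrightarrow Q$ be a surjective quandle homomorphism. For $x\in P$ and $\varphi\in\mathrm{Inn}_{\mathrm{rel}}(f)$, it holds that $s_{\varphi(x)}=[\varphi,s_x]s_x$ and $[s_x,s_{\varphi(x)}]=[[\varphi,s_x],s_x]^{-1}$. Consequently, the following hold. (1) $f$ is $1$-nilpotent if and only if $[\varphi,s_x]=1$ for every $x\in P$ and $\varphi\in\mathrm{Inn}_{\mathrm{rel}}(f)$. (2) $f$ is reduced if and only if $[\varphi,s_x](x)=x$ for every $x\in P$ and $\varphi\in\mathrm{Inn}_{\mathrm{rel}}(f)$. (3) $f$ is operator-reduced if and only if $[[\varphi,s_x],s_x]=1$ for every $x\in P$ and $\varphi\in\mathrm{Inn}_{\mathrm{rel}}(f)$. In particular, every $1$-nilpotent homomorphism is reduced, every reduced homomorphism is operator-reduced, and every $2$-nilpotent homomorphism is operator-reduced.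
   Context: A quandle is a set $Q$ with a map $s_x\colon Q\to Q$ for each $x\in Q$ such that, for all $x,y\in Q$, $s_x(x)=x$, $s_x$ is bijective, and $s_x\circ s_y=s_{s_x(y)}\circ s_x$. A quandle homomorphism is a map $f\colon P\to Q$ with $f\circ s_x=s_{f(x)}\circ f$ for all $x\in P$. The inner automorphism group $\mathrm{Inn}(Q)$ is the subgroup of $\mathrm{Aut}(Q)$ generated by all $s_x$. For a surjective quandle homomorphism $f\colon P\twoheadrightarrow Q$ there is a unique surjective group homomorphism $f_*\colon\mathrm{Inn}(P)\to\mathrm{Inn}(Q)$ with $f_*(s_x)=s_{f(x)}$; put $\mathrm{Inn}_{\mathrm{rel}}(f)=\mathrm{Ker}(f_* )$. Commutators: $[x,y]=xyx^{-1}y^{-1}$; $[A,B]$ is the subgroup generated by all $[a,b]$. For $N\trianglelefteq G$ put $\Gamma_0(G,N)=N$, $\Gamma_{i+1}(G,N)=[G,\Gamma_i(G,N)]$. The surjective homomorphism $f$ is $c$-nilpotent if $\Gamma_c(\mathrm{Inn}(P),\mathrm{Inn}_{\mathrm{rel}}(f))=1$. It is reduced if $s_{\varphi(x)}(x)=x$, and operator-reduced if $s_xs_{\varphi(x)}=s_{\varphi(x)}s_x$, for every $x\in P$ and every $\varphi\in\mathrm{Inn}_{\mathrm{rel}}(f)$. *)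

theory Defs
  imports "HOL-Algebra.Bij" "HOL-Algebra.Generated_Groups"
begin

section \<open>Quandles\<close>

text \<open>A quandle is given on an explicit, possibly empty, carrier; \<open>qsym Q x\<close> is only
  meaningful on the carrier, and \<open>pt_sym Q x\<close> is its extensional version, which is the element
  of \<open>BijGroup (carrier Q)\<close> representing the point symmetry \<open>s\<^sub>x\<close>.\<close>

record 'a quandle = "'a partial_object" +
  qsym :: "'a \<Rightarrow> 'a \<Rightarrow> 'a"

locale quandle =
  fixes Q :: "('a, 'm) quandle_scheme"
  assumes qsym_self: "x \<in> carrier Q \<Longrightarrow> qsym Q x x = x"
    and qsym_bij: "x \<in> carrier Q \<Longrightarrow> bij_betw (qsym Q x) (carrier Q) (carrier Q)"
    and qsym_distrib:
      "\<lbrakk>x \<in> carrier Q; y \<in> carrier Q; z \<in> carrier Q\<rbrakk>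
        \<Longrightarrow> qsym Q x (qsym Q y z) = qsym Q (qsym Q x y) (qsym Q x z)"

definition pt_sym :: "('a, 'm) quandle_scheme \<Rightarrow> 'a \<Rightarrow> 'a \<Rightarrow> 'a"
  where "pt_sym Q x = restrict (qsym Q x) (carrier Q)"

definition quandle_hom ::
    "('a, 'm) quandle_scheme \<Rightarrow> ('b, 'n) quandle_scheme \<Rightarrow> ('a \<Rightarrow> 'b) set"
  where "quandle_hom P Q =
    {f \<in> carrier P \<rightarrow> carrier Q.
      \<forall>x\<in>carrier P. \<forall>y\<in>carrier P. f (qsym P x y) = qsym Q (f x) (f y)}"

definition quandle_auto :: "('a, 'm) quandle_scheme \<Rightarrow> ('a \<Rightarrow> 'a) set"
  where "quandle_auto Q = quandle_hom Q Q \<inter> Bij (carrier Q)"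

text \<open>Multiplication in these groups is composition of maps, the right factor being applied
  first.\<close>

definition QAut :: "('a, 'm) quandle_scheme \<Rightarrow> ('a \<Rightarrow> 'a) monoid"
  where "QAut Q = BijGroup (carrier Q) \<lparr>carrier := quandle_auto Q\<rparr>"

definition Inn :: "('a, 'm) quandle_scheme \<Rightarrow> ('a \<Rightarrow> 'a) monoid"
  where "Inn Q = QAut Q \<lparr>carrier := generate (QAut Q) (pt_sym Q ` carrier Q)\<rparr>"

text \<open>\<open>inn_map P Q f\<close> is the induced homomorphism \<open>f\<^sub>* : Inn P \<rightarrow> Inn Q\<close> of a surjective
  quandle homomorphism \<open>f\<close>; its existence and uniqueness are shown in \<open>inn_map_ex1\<close> below.
  Extensionality only fixes the irrelevant values outside \<open>Inn P\<close>.\<close>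

definition inn_map ::
    "('a, 'm) quandle_scheme \<Rightarrow> ('b, 'n) quandle_scheme \<Rightarrow> ('a \<Rightarrow> 'b)
      \<Rightarrow> ('a \<Rightarrow> 'a) \<Rightarrow> ('b \<Rightarrow> 'b)"
  where "inn_map P Q f =
    (THE h. h \<in> epi (Inn P) (Inn Q) \<and> h \<in> extensional (carrier (Inn P)) \<and>
      (\<forall>x\<in>carrier P. h (pt_sym P x) = pt_sym Q (f x)))"

definition Inn_rel ::
    "('a, 'm) quandle_scheme \<Rightarrow> ('b, 'n) quandle_scheme \<Rightarrow> ('a \<Rightarrow> 'b) \<Rightarrow> ('a \<Rightarrow> 'a) set"
  where "Inn_rel P Q f = kernel (Inn P) (Inn Q) (inn_map P Q f)"


section \<open>Commutators and the relative lower central series\<close>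

definition commutator :: "('a, 'm) monoid_scheme \<Rightarrow> 'a \<Rightarrow> 'a \<Rightarrow> 'a"
  where "commutator G x y = x \<otimes>\<^bsub>G\<^esub> y \<otimes>\<^bsub>G\<^esub> inv\<^bsub>G\<^esub> x \<otimes>\<^bsub>G\<^esub> inv\<^bsub>G\<^esub> y"

definition commutator_subgroup :: "('a, 'm) monoid_scheme \<Rightarrow> 'a set \<Rightarrow> 'a set \<Rightarrow> 'a set"
  where "commutator_subgroup G A B = generate G {commutator G a b |a b. a \<in> A \<and> b \<in> B}"

primrec rel_lower_central :: "('a, 'm) monoid_scheme \<Rightarrow> 'a set \<Rightarrow> nat \<Rightarrow> 'a set"
  where
    "rel_lower_central G N 0 = N"
  | "rel_lower_central G N (Suc i) = commutator_subgroup G (carrier G) (rel_lower_central G N i)"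


section \<open>Classes of surjective quandle homomorphisms\<close>

definition nilpotent_hom ::
    "nat \<Rightarrow> ('a, 'm) quandle_scheme \<Rightarrow> ('b, 'n) quandle_scheme \<Rightarrow> ('a \<Rightarrow> 'b) \<Rightarrow> bool"
  where "nilpotent_hom c P Q f \<longleftrightarrow>
    rel_lower_central (Inn P) (Inn_rel P Q f) c = {\<one>\<^bsub>Inn P\<^esub>}"

definition reduced_hom ::
    "('a, 'm) quandle_scheme \<Rightarrow> ('b, 'n) quandle_scheme \<Rightarrow> ('a \<Rightarrow> 'b) \<Rightarrow> bool"
  where "reduced_hom P Q f \<longleftrightarrow>
    (\<forall>x\<in>carrier P. \<forall>\<phi>\<in>Inn_rel P Q f. qsym P (\<phi> x) x = x)"

definition operator_reduced_hom ::
    "('a, 'm) quandle_scheme \<Rightarrow> ('b, 'n) quandle_scheme \<Rightarrow> ('a \<Rightarrow> 'b) \<Rightarrow> bool"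
  where "operator_reduced_hom P Q f \<longleftrightarrow>
    (\<forall>x\<in>carrier P. \<forall>\<phi>\<in>Inn_rel P Q f.
      pt_sym P x \<otimes>\<^bsub>Inn P\<^esub> pt_sym P (\<phi> x) = pt_sym P (\<phi> x) \<otimes>\<^bsub>Inn P\<^esub> pt_sym P x)"


section \<open>The induced homomorphism is well defined\<close>

context quandle
begin

lemma qsym_closed: "\<lbrakk>x \<in> carrier Q; y \<in> carrier Q\<rbrakk> \<Longrightarrow> qsym Q x y \<in> carrier Q"
  using qsym_bij bij_betwE by blast

lemma subgroup_quandle_auto: "subgroup (quandle_auto Q) (BijGroup (carrier Q))"
proof (rule subgroup.intro)
  show "quandle_auto Q \<subseteq> carrier (BijGroup (carrier Q))"
    by (auto simp: quandle_auto_def BijGroup_def)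
next
  fix g h assume gh: "g \<in> quandle_auto Q" "h \<in> quandle_auto Q"
  then have "compose (carrier Q) g h \<in> Bij (carrier Q)"
    by (auto simp: quandle_auto_def intro: compose_Bij)
  moreover have "compose (carrier Q) g h \<in> quandle_hom Q Q"
    using gh by (auto simp: quandle_auto_def quandle_hom_def compose_def qsym_closed Pi_iff)
  ultimately show "g \<otimes>\<^bsub>BijGroup (carrier Q)\<^esub> h \<in> quandle_auto Q"
    using gh by (simp add: quandle_auto_def BijGroup_def)
next
  show "\<one>\<^bsub>BijGroup (carrier Q)\<^esub> \<in> quandle_auto Q"
    by (auto simp: BijGroup_def quandle_auto_def quandle_hom_def id_Bij qsym_closed)
next
  fix g assume g: "g \<in> quandle_auto Q"
  then have B: "g \<in> Bij (carrier Q)" by (simp add: quandle_auto_def)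
  have "inv_into (carrier Q) g (qsym Q x y)
      = qsym Q (inv_into (carrier Q) g x) (inv_into (carrier Q) g y)"
    if "x \<in> carrier Q" "y \<in> carrier Q" for x y
    by (rule Bij_inv_into_lemma[of "carrier Q" g "\<lambda>x y. qsym Q x y"])
      (use g B that in \<open>auto simp: quandle_auto_def quandle_hom_def qsym_closed\<close>)
  then show "inv\<^bsub>BijGroup (carrier Q)\<^esub> g \<in> quandle_auto Q"
    using B by (auto simp: inv_BijGroup quandle_auto_def quandle_hom_def restrict_inv_into_Bij
        Bij_inv_into_mem qsym_closed)
qed

lemma group_QAut: "group (QAut Q)"
  unfolding QAut_def
  by (rule subgroup.subgroup_is_group[OF subgroup_quandle_auto group_BijGroup])

lemma pt_sym_auto: "x \<in> carrier Q \<Longrightarrow> pt_sym Q x \<in> carrier (QAut Q)"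
  using qsym_bij[of x] qsym_distrib[of x]
  by (auto simp: QAut_def quandle_auto_def quandle_hom_def pt_sym_def Bij_def qsym_closed
      cong: bij_betw_cong)

lemma subgroup_Inn: "subgroup (carrier (Inn Q)) (QAut Q)"
  unfolding Inn_def
  by (simp add: group.generate_is_subgroup group_QAut image_subset_iff pt_sym_auto)

lemma group_Inn: "group (Inn Q)"
  using subgroup.subgroup_is_group[OF subgroup_Inn group_QAut] by (simp add: Inn_def)

lemma pt_sym_Inn: "x \<in> carrier Q \<Longrightarrow> pt_sym Q x \<in> carrier (Inn Q)"
  by (simp add: Inn_def generate.incl)

lemma Inn_auto: "\<phi> \<in> carrier (Inn Q) \<Longrightarrow> \<phi> \<in> quandle_auto Q"
  using subgroup.subset[OF subgroup_Inn] by (auto simp: QAut_def)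

lemma Inn_Bij: "\<phi> \<in> carrier (Inn Q) \<Longrightarrow> \<phi> \<in> Bij (carrier Q)"
  using Inn_auto by (simp add: quandle_auto_def)

lemma Inn_closed: "\<lbrakk>\<phi> \<in> carrier (Inn Q); x \<in> carrier Q\<rbrakk> \<Longrightarrow> \<phi> x \<in> carrier Q"
  using Inn_Bij Bij_imp_funcset by blast

lemma Inn_mult:
  "\<lbrakk>\<phi> \<in> carrier (Inn Q); \<psi> \<in> carrier (Inn Q)\<rbrakk> \<Longrightarrow> \<phi> \<otimes>\<^bsub>Inn Q\<^esub> \<psi> = compose (carrier Q) \<phi> \<psi>"
  by (frule Inn_Bij, drule Inn_Bij[of \<psi>]) (simp add: Inn_def QAut_def BijGroup_def)

lemma Inn_one: "\<one>\<^bsub>Inn Q\<^esub> = (\<lambda>x\<in>carrier Q. x)"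
  by (simp add: Inn_def QAut_def BijGroup_def)

lemma Inn_inv_cancel:
  assumes "\<phi> \<in> carrier (Inn Q)" "x \<in> carrier Q"
  shows "\<phi> ((inv\<^bsub>Inn Q\<^esub> \<phi>) x) = x" "(inv\<^bsub>Inn Q\<^esub> \<phi>) (\<phi> x) = x"
proof -
  interpret I: group "Inn Q" by (rule group_Inn)
  have i: "inv\<^bsub>Inn Q\<^esub> \<phi> \<in> carrier (Inn Q)" using assms by simp
  show "\<phi> ((inv\<^bsub>Inn Q\<^esub> \<phi>) x) = x"
    using I.r_inv[OF assms(1)] assms i Inn_mult[OF assms(1) i]
    by (simp add: Inn_one) (metis compose_eq restrict_apply')
  show "(inv\<^bsub>Inn Q\<^esub> \<phi>) (\<phi> x) = x"
    using I.l_inv[OF assms(1)] assms i Inn_mult[OF i assms(1)]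
    by (simp add: Inn_one) (metis compose_eq restrict_apply')
qed

lemma Inn_induct [consumes 1, case_names one pt_sym inv mult]:
  assumes \<phi>: "\<phi> \<in> carrier (Inn Q)"
    and "R \<one>\<^bsub>Inn Q\<^esub>"
    and "\<And>x. x \<in> carrier Q \<Longrightarrow> R (pt_sym Q x)"
    and "\<And>x. x \<in> carrier Q \<Longrightarrow> R (inv\<^bsub>Inn Q\<^esub> (pt_sym Q x))"
    and "\<And>\<phi> \<psi>. \<lbrakk>\<phi> \<in> carrier (Inn Q); \<psi> \<in> carrier (Inn Q); R \<phi>; R \<psi>\<rbrakk> \<Longrightarrow> R (\<phi> \<otimes>\<^bsub>Inn Q\<^esub> \<psi>)"
  shows "R \<phi>"
proof -
  have inv_eq: "inv\<^bsub>QAut Q\<^esub> \<psi> = inv\<^bsub>Inn Q\<^esub> \<psi>" if "\<psi> \<in> carrier (Inn Q)" for \<psi>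
    using group.m_inv_consistent[OF group_QAut subgroup_Inn that] by (simp add: Inn_def)
  have "\<phi> \<in> generate (QAut Q) (pt_sym Q ` carrier Q)" using \<phi> by (simp add: Inn_def)
  then show ?thesis
  proof induction
    case one then show ?case using assms(2) by (simp add: Inn_def)
  next
    case (incl h) then show ?case using assms(3) by auto
  next
    case (inv h) then show ?case using assms(4) inv_eq pt_sym_Inn by auto
  next
    case (eng h1 h2) then show ?case using assms(5)[of h1 h2] by (simp add: Inn_def)
  qed
qed

end

lemma inn_map_ex1:
  assumes "quandle P" "quandle Q" and f: "f \<in> quandle_hom P Q" "f ` carrier P = carrier Q"
  shows "\<exists>!h. h \<in> epi (Inn P) (Inn Q) \<and> h \<in> extensional (carrier (Inn P)) \<and>
    (\<forall>x\<in>carrier P. h (pt_sym P x) = pt_sym Q (f x))"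
proof -
  interpret P: quandle P by fact
  interpret Q: quandle Q by fact
  interpret IP: group "Inn P" by (rule P.group_Inn)
  interpret IQ: group "Inn Q" by (rule Q.group_Inn)
  define L where "L \<phi> \<psi> \<longleftrightarrow> \<psi> \<in> carrier (Inn Q) \<and> (\<forall>x\<in>carrier P. \<psi> (f x) = f (\<phi> x))" for \<phi> \<psi>
  have fc: "f x \<in> carrier Q" if "x \<in> carrier P" for x using f that by auto
  have L_one: "L \<one>\<^bsub>Inn P\<^esub> \<one>\<^bsub>Inn Q\<^esub>"
    by (auto simp: L_def P.Inn_one Q.Inn_one fc IQ.one_closed[unfolded Q.Inn_one])
  have L_sym: "L (pt_sym P x) (pt_sym Q (f x))" if "x \<in> carrier P" for x
    using that f(1) by (auto simp: L_def fc Q.pt_sym_Inn) (auto simp: pt_sym_def quandle_hom_def)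
  have L_inv: "L (inv\<^bsub>Inn P\<^esub> \<phi>) (inv\<^bsub>Inn Q\<^esub> \<psi>)" if "\<phi> \<in> carrier (Inn P)" "L \<phi> \<psi>" for \<phi> \<psi>
    unfolding L_def
  proof (intro conjI ballI)
    show "inv\<^bsub>Inn Q\<^esub> \<psi> \<in> carrier (Inn Q)" using that by (simp add: L_def)
    fix x assume x: "x \<in> carrier P"
    define y where "y = (inv\<^bsub>Inn P\<^esub> \<phi>) x"
    have y: "y \<in> carrier P" using that x by (auto simp: y_def intro: P.Inn_closed)
    have "f x = \<psi> (f y)" using that x y P.Inn_inv_cancel(1)[of \<phi> x] by (simp add: L_def y_def)
    then show "(inv\<^bsub>Inn Q\<^esub> \<psi>) (f x) = f ((inv\<^bsub>Inn P\<^esub> \<phi>) x)"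
      using Q.Inn_inv_cancel(2)[of \<psi> "f y"] that y fc by (simp add: L_def y_def)
  qed
  have L_mult: "L (\<phi> \<otimes>\<^bsub>Inn P\<^esub> \<phi>') (\<psi> \<otimes>\<^bsub>Inn Q\<^esub> \<psi>')"
    if "\<phi> \<in> carrier (Inn P)" "\<phi>' \<in> carrier (Inn P)" "L \<phi> \<psi>" "L \<phi>' \<psi>'" for \<phi> \<phi>' \<psi> \<psi>'
    using that IQ.m_closed[of \<psi> \<psi>']
    by (auto simp: L_def P.Inn_mult Q.Inn_mult compose_eq fc P.Inn_closed)
  have L_ex: "\<exists>\<psi>. L \<phi> \<psi>" if "\<phi> \<in> carrier (Inn P)" for \<phi>
    using that by (induction rule: P.Inn_induct) (blast intro: L_one L_sym L_inv L_mult P.pt_sym_Inn)+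
  have L_surj: "\<exists>\<phi>\<in>carrier (Inn P). L \<phi> \<psi>" if "\<psi> \<in> carrier (Inn Q)" for \<psi>
    using that
  proof (induction rule: Q.Inn_induct)
    case one show ?case using L_one by blast
  next
    case (pt_sym x)
    then obtain z where "z \<in> carrier P" "x = f z" using f by blast
    then show ?case using L_sym P.pt_sym_Inn by blast
  next
    case (inv x)
    then obtain z where "z \<in> carrier P" "x = f z" using f by blast
    then show ?case using L_sym L_inv P.pt_sym_Inn IP.inv_closed by blast
  next
    case (mult \<phi> \<psi>)
    then show ?case using L_mult IP.m_closed by blast
  qed
  have L_unique: "\<psi> = \<psi>'" if "L \<phi> \<psi>" "L \<phi> \<psi>'" for \<phi> \<psi> \<psi>'
  proof (rule extensionalityI[of _ "carrier Q"])
    show "\<psi> \<in> extensional (carrier Q)" "\<psi>' \<in> extensional (carrier Q)"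
      using that Q.Inn_Bij by (auto simp: L_def Bij_def)
    fix y assume "y \<in> carrier Q"
    then obtain z where "z \<in> carrier P" "y = f z" using f by blast
    then show "\<psi> y = \<psi>' y" using that by (simp add: L_def)
  qed
  define h where "h = (\<lambda>\<phi>\<in>carrier (Inn P). THE \<psi>. L \<phi> \<psi>)"
  have h_eq: "h \<phi> = \<psi>" if "\<phi> \<in> carrier (Inn P)" "L \<phi> \<psi>" for \<phi> \<psi>
    using that(1) the_equality[of "L \<phi>", OF that(2)] L_unique[OF _ that(2)] by (simp add: h_def)
  have h_L: "L \<phi> (h \<phi>)" if "\<phi> \<in> carrier (Inn P)" for \<phi>
    using L_ex[OF that] h_eq[OF that] by blast
  show ?thesis
  proof (rule ex1I[of _ h])
    have "h \<in> hom (Inn P) (Inn Q)"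
    proof (rule homI)
      show "h \<phi> \<in> carrier (Inn Q)" if "\<phi> \<in> carrier (Inn P)" for \<phi>
        using h_L[OF that] by (simp add: L_def)
      show "h (\<phi> \<otimes>\<^bsub>Inn P\<^esub> \<phi>') = h \<phi> \<otimes>\<^bsub>Inn Q\<^esub> h \<phi>'"
        if "\<phi> \<in> carrier (Inn P)" "\<phi>' \<in> carrier (Inn P)" for \<phi> \<phi>'
        using that by (intro h_eq L_mult h_L IP.m_closed)
    qed
    moreover have "h ` carrier (Inn P) = carrier (Inn Q)"
      using h_L L_surj h_eq by (fastforce simp: L_def image_iff)
    ultimately show "h \<in> epi (Inn P) (Inn Q) \<and> h \<in> extensional (carrier (Inn P)) \<and>
        (\<forall>x\<in>carrier P. h (pt_sym P x) = pt_sym Q (f x))"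
      by (auto simp: epi_def h_eq L_sym P.pt_sym_Inn) (simp add: h_def)
  next
    fix k assume k: "k \<in> epi (Inn P) (Inn Q) \<and> k \<in> extensional (carrier (Inn P)) \<and>
        (\<forall>x\<in>carrier P. k (pt_sym P x) = pt_sym Q (f x))"
    then interpret K: group_hom "Inn P" "Inn Q" k
      by unfold_locales (simp add: epi_def)
    have "L \<phi> (k \<phi>)" if "\<phi> \<in> carrier (Inn P)" for \<phi>
      using that
    proof (induction rule: P.Inn_induct)
      case one show ?case using L_one by simp
    next
      case (pt_sym x) then show ?case using L_sym k by simp
    next
      case (inv x)
      then have "k (inv\<^bsub>Inn P\<^esub> pt_sym P x) = inv\<^bsub>Inn Q\<^esub> pt_sym Q (f x)"
        using k by (simp add: P.pt_sym_Inn)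
      with inv show ?case by (simp add: L_inv L_sym P.pt_sym_Inn)
    next
      case (mult \<phi> \<psi>) then show ?case by (simp add: L_mult)
    qed
    then show "k = h"
      using k h_eq[symmetric]
      by (intro extensionalityI[of _ "carrier (Inn P)"]) (simp, simp add: h_def, blast)
  qed
qed

lemma inn_map_properties:
  assumes "quandle P" "quandle Q" "f \<in> quandle_hom P Q" "f ` carrier P = carrier Q"
  shows "inn_map P Q f \<in> epi (Inn P) (Inn Q)"
    and "\<And>x. x \<in> carrier P \<Longrightarrow> inn_map P Q f (pt_sym P x) = pt_sym Q (f x)"
  using theI'[OF inn_map_ex1[OF assms]] by (simp_all add: inn_map_def)

end

theory Submission
  imports Defs
begin

text \<open>Since an inner automorphism \<open>\<phi>\<close> is a quandle automorphism, \<open>s\<^bsub>\<phi>(x)\<^esub> = \<phi> s\<^sub>x \<phi>\<^sup>-\<^sup>1\<close>, and the two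
  formulas are identities in the group generated by \<open>\<phi>\<close> and \<open>s\<^sub>x\<close>. For (1), an element commuting
  with all point symmetries is central in \<open>Inn P\<close>. If \<open>f\<close> is reduced, conjugation of \<open>s\<^sub>x\<close> by
  \<open>s\<^bsub>\<phi>(x)\<^esub>\<close> gives the point symmetry at \<open>s\<^bsub>\<phi>(x)\<^esub>(x) = x\<close>, so the two commute. If \<open>f\<close> is
  \<open>2\<close>-nilpotent, \<open>[\<phi>, s\<^sub>x] = [s\<^sub>x, \<phi>]\<^sup>-\<^sup>1\<close> lies in \<open>\<Gamma>\<^sub>1\<close>, which is central.\<close>

context group
begin

lemma commutator_closed [simp, intro]:
  "\<lbrakk>x \<in> carrier G; y \<in> carrier G\<rbrakk> \<Longrightarrow> commutator G x y \<in> carrier G"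
  by (simp add: commutator_def)

lemma commutator_mult_swap:
  "\<lbrakk>x \<in> carrier G; y \<in> carrier G\<rbrakk> \<Longrightarrow> commutator G x y \<otimes> (y \<otimes> x) = x \<otimes> y"
  by (simp add: commutator_def m_assoc inv_solve_left')

lemma commutator_eq_one_iff:
  assumes "x \<in> carrier G" "y \<in> carrier G"
  shows "commutator G x y = \<one> \<longleftrightarrow> x \<otimes> y = y \<otimes> x"
  using right_cancel[of "y \<otimes> x" "commutator G x y" \<one>] commutator_mult_swap[OF assms] assms
  by simp

lemma commutator_eq_one_commute:
  "\<lbrakk>x \<in> carrier G; y \<in> carrier G\<rbrakk> \<Longrightarrow> commutator G x y = \<one> \<longleftrightarrow> commutator G y x = \<one>"
  by (auto simp: commutator_eq_one_iff)

lemma inv_commutator: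
  "\<lbrakk>x \<in> carrier G; y \<in> carrier G\<rbrakk> \<Longrightarrow> inv (commutator G x y) = commutator G y x"
  by (simp add: commutator_def inv_mult_group m_assoc)

lemma commutator_mult_right:
  "\<lbrakk>x \<in> carrier G; y \<in> carrier G\<rbrakk> \<Longrightarrow> commutator G x y \<otimes> y = x \<otimes> y \<otimes> inv x"
  by (simp add: commutator_def m_assoc)

text \<open>Conjugating \<open>y\<close> by \<open>x \<otimes> y\<close> has the same effect as
  conjugating it by \<open>x\<close>, because \<open>y\<close> commutes with itself.\<close>

lemma commutator_translate_left:
  assumes "x \<in> carrier G" "y \<in> carrier G"
  shows "commutator G (x \<otimes> y) y = commutator G x y"
proof -
  \<comment> \<open>Cancellation in the right-nested form that products take under
    \<open>m_assoc\<close>.\<close>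
  have "y \<otimes> (inv y \<otimes> z) = z" if "z \<in> carrier G" for z
    using assms that by (simp flip: m_assoc)
  then show ?thesis using assms by (simp add: commutator_def inv_mult_group m_assoc)
qed

lemma mult_inv_commute:
  assumes "x \<in> carrier G" "y \<in> carrier G" "x \<otimes> y = y \<otimes> x"
  shows "x \<otimes> inv y = inv y \<otimes> x"
proof -
  have "y \<otimes> (x \<otimes> inv y) = x \<otimes> y \<otimes> inv y" using assms by (simp add: m_assoc)
  also have "\<dots> = x" using assms(1,2) by (simp add: m_assoc)
  finally show ?thesis using assms(1,2) by (simp add: inv_solve_left)
qed

text \<open>A generated subgroup is trivial exactly when all its generators are. This turns
  nilpotency into a condition on single commutators.\<close>

lemma commutator_subgroup_eq_one_iff:
  assumes "A \<subseteq> carrier G" "B \<subseteq> carrier G"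
  shows "commutator_subgroup G A B = {\<one>} \<longleftrightarrow> (\<forall>a\<in>A. \<forall>b\<in>B. commutator G a b = \<one>)"
proof
  assume "commutator_subgroup G A B = {\<one>}"
  then show "\<forall>a\<in>A. \<forall>b\<in>B. commutator G a b = \<one>"
    by (auto simp: commutator_subgroup_def dest: equalityD1 intro: generate.incl)
next
  assume "\<forall>a\<in>A. \<forall>b\<in>B. commutator G a b = \<one>"
  then have "{commutator G a b |a b. a \<in> A \<and> b \<in> B} \<subseteq> {\<one>}" by auto
  then have "commutator_subgroup G A B \<subseteq> {\<one>}"
    unfolding commutator_subgroup_def using generate_one mono_generate by blast
  then show "commutator_subgroup G A B = {\<one>}"
    by (auto simp: commutator_subgroup_def intro: generate.one)
qed

lemma commutator_subgroup_closed:
  assumes "A \<subseteq> carrier G" "B \<subseteq> carrier G"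
  shows "commutator_subgroup G A B \<subseteq> carrier G"
  unfolding commutator_subgroup_def by (rule generate_incl) (use assms in auto)

end

context quandle
begin

lemma pt_sym_image:
  assumes \<phi>: "\<phi> \<in> carrier (Inn Q)" and x: "x \<in> carrier Q"
  shows "pt_sym Q (\<phi> x) = \<phi> \<otimes>\<^bsub>Inn Q\<^esub> pt_sym Q x \<otimes>\<^bsub>Inn Q\<^esub> inv\<^bsub>Inn Q\<^esub> \<phi>"
proof -
  interpret I: group "Inn Q" by (rule group_Inn)
  note [simp] = pt_sym_Inn[OF x] pt_sym_Inn[OF Inn_closed[OF \<phi> x]] \<phi> x
  have "pt_sym Q (\<phi> x) \<otimes>\<^bsub>Inn Q\<^esub> \<phi> = \<phi> \<otimes>\<^bsub>Inn Q\<^esub> pt_sym Q x"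
  proof -
    have "qsym Q (\<phi> x) (\<phi> y) = \<phi> (qsym Q x y)" if "y \<in> carrier Q" for y
      using Inn_auto[OF \<phi>] that x by (simp add: quandle_auto_def quandle_hom_def)
    then show ?thesis
      \<comment> \<open>Both products are restrictions to the carrier, so agreement at each of its
        points suffices.\<close>
      by (simp add: Inn_mult compose_def) (auto simp: pt_sym_def Inn_closed intro!: restrict_ext)
  qed
  then show ?thesis by (simp add: I.inv_solve_right)
qed

lemma pt_sym_image_commutator:
  assumes "\<phi> \<in> carrier (Inn Q)" "x \<in> carrier Q"
  shows "pt_sym Q (\<phi> x) = commutator (Inn Q) \<phi> (pt_sym Q x) \<otimes>\<^bsub>Inn Q\<^esub> pt_sym Q x"
  using assms by (simp add: pt_sym_image group.commutator_mult_right group_Inn pt_sym_Inn)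

text \<open>With u = [\<phi>, s_x] the point symmetry at \<phi>(x) is u s_x. Inversion swaps the
  arguments of a commutator, and the factor s_x drops out of [u s_x, s_x].\<close>

lemma commutator_pt_sym_image:
  assumes "\<phi> \<in> carrier (Inn Q)" "x \<in> carrier Q"
  shows "commutator (Inn Q) (pt_sym Q x) (pt_sym Q (\<phi> x))
    = inv\<^bsub>Inn Q\<^esub> (commutator (Inn Q) (commutator (Inn Q) \<phi> (pt_sym Q x)) (pt_sym Q x))"
proof -
  interpret I: group "Inn Q" by (rule group_Inn)
  let ?s = "pt_sym Q x" and ?u = "commutator (Inn Q) \<phi> (pt_sym Q x)"
  have c: "?s \<in> carrier (Inn Q)" "?u \<in> carrier (Inn Q)" using assms by (simp_all add: pt_sym_Inn)
  have "inv\<^bsub>Inn Q\<^esub> (commutator (Inn Q) ?u ?s) = inv\<^bsub>Inn Q\<^esub> (commutator (Inn Q) (?u \<otimes>\<^bsub>Inn Q\<^esub> ?s) ?s)"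
    using c by (simp add: I.commutator_translate_left)
  also have "\<dots> = commutator (Inn Q) ?s (?u \<otimes>\<^bsub>Inn Q\<^esub> ?s)" using c by (simp add: I.inv_commutator)
  finally show ?thesis using pt_sym_image_commutator[OF assms] by simp
qed

text \<open>Since s_x fixes x, the maps [\<phi>, s_x] s_x and [\<phi>, s_x] agree at x.\<close>

lemma qsym_image_eq_commutator:
  assumes "\<phi> \<in> carrier (Inn Q)" "x \<in> carrier Q"
  shows "qsym Q (\<phi> x) x = commutator (Inn Q) \<phi> (pt_sym Q x) x"
proof -
  interpret I: group "Inn Q" by (rule group_Inn)
  have "qsym Q (\<phi> x) x = pt_sym Q (\<phi> x) x" using assms by (simp add: pt_sym_def)
  also have "\<dots> = commutator (Inn Q) \<phi> (pt_sym Q x) (pt_sym Q x x)"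
    using assms by (simp add: pt_sym_image_commutator Inn_mult pt_sym_Inn compose_eq)
  finally show ?thesis using assms by (simp add: pt_sym_def qsym_self)
qed

lemma pt_sym_commute_if_fixed:
  assumes "x \<in> carrier Q" "y \<in> carrier Q" "qsym Q y x = x"
  shows "pt_sym Q x \<otimes>\<^bsub>Inn Q\<^esub> pt_sym Q y = pt_sym Q y \<otimes>\<^bsub>Inn Q\<^esub> pt_sym Q x"
proof -
  interpret I: group "Inn Q" by (rule group_Inn)
  have "pt_sym Q y x = x" using assms by (simp add: pt_sym_def)
  then have "pt_sym Q x = pt_sym Q y \<otimes>\<^bsub>Inn Q\<^esub> pt_sym Q x \<otimes>\<^bsub>Inn Q\<^esub> inv\<^bsub>Inn Q\<^esub> pt_sym Q y"
    using pt_sym_image[of "pt_sym Q y" x] assms by (simp add: pt_sym_Inn)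
  then show ?thesis
    using assms(1,2) by (simp add: I.inv_solve_right pt_sym_Inn)
qed

text \<open>The centralizer of \<phi> is closed under products and inverses, so it contains the
  whole group once it contains the generators.\<close>

lemma Inn_central_if_commutes_pt_sym:
  assumes \<phi>: "\<phi> \<in> carrier (Inn Q)" and \<psi>: "\<psi> \<in> carrier (Inn Q)"
    and s: "\<And>x. x \<in> carrier Q \<Longrightarrow> \<phi> \<otimes>\<^bsub>Inn Q\<^esub> pt_sym Q x = pt_sym Q x \<otimes>\<^bsub>Inn Q\<^esub> \<phi>"
  shows "\<phi> \<otimes>\<^bsub>Inn Q\<^esub> \<psi> = \<psi> \<otimes>\<^bsub>Inn Q\<^esub> \<phi>"
proof -
  interpret I: group "Inn Q" by (rule group_Inn)
  show ?thesis
    using \<psi>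
  proof (induction rule: Inn_induct)
    case one show ?case using \<phi> by simp
  next
    case (pt_sym x) then show ?case by (rule s)
  next
    case (inv x)
    then show ?case
      using s[of x] \<phi> by (simp add: I.mult_inv_commute pt_sym_Inn)
  next
    case (mult \<psi> \<chi>)
    then have "\<phi> \<otimes>\<^bsub>Inn Q\<^esub> (\<psi> \<otimes>\<^bsub>Inn Q\<^esub> \<chi>) = \<psi> \<otimes>\<^bsub>Inn Q\<^esub> \<phi> \<otimes>\<^bsub>Inn Q\<^esub> \<chi>"
      using \<phi> by (simp flip: I.m_assoc)
    then show ?case using mult \<phi> by (simp add: I.m_assoc)
  qed
qed

end

theorem proposition4p2:
  fixes P :: "('a, 'm) quandle_scheme" and Q :: "('b, 'n) quandle_scheme" and f :: "'a \<Rightarrow> 'b"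
  assumes "quandle P" and "quandle Q"
    and "f \<in> quandle_hom P Q" and "f ` carrier P = carrier Q"
  shows "(\<forall>x\<in>carrier P. \<forall>\<phi>\<in>Inn_rel P Q f.
        pt_sym P (\<phi> x) = commutator (Inn P) \<phi> (pt_sym P x) \<otimes>\<^bsub>Inn P\<^esub> pt_sym P x
      \<and> commutator (Inn P) (pt_sym P x) (pt_sym P (\<phi> x))
          = inv\<^bsub>Inn P\<^esub> (commutator (Inn P) (commutator (Inn P) \<phi> (pt_sym P x)) (pt_sym P x)))
    \<and> (nilpotent_hom 1 P Q f \<longleftrightarrow>
        (\<forall>x\<in>carrier P. \<forall>\<phi>\<in>Inn_rel P Q f. commutator (Inn P) \<phi> (pt_sym P x) = \<one>\<^bsub>Inn P\<^esub>))
    \<and> (reduced_hom P Q f \<longleftrightarrow>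
        (\<forall>x\<in>carrier P. \<forall>\<phi>\<in>Inn_rel P Q f. (commutator (Inn P) \<phi> (pt_sym P x)) x = x))
    \<and> (operator_reduced_hom P Q f \<longleftrightarrow>
        (\<forall>x\<in>carrier P. \<forall>\<phi>\<in>Inn_rel P Q f.
          commutator (Inn P) (commutator (Inn P) \<phi> (pt_sym P x)) (pt_sym P x) = \<one>\<^bsub>Inn P\<^esub>))
    \<and> (nilpotent_hom 1 P Q f \<longrightarrow> reduced_hom P Q f)
    \<and> (reduced_hom P Q f \<longrightarrow> operator_reduced_hom P Q f)
    \<and> (nilpotent_hom 2 P Q f \<longrightarrow> operator_reduced_hom P Q f)"
proof -
  interpret P: quandle P by fact
  interpret I: group "Inn P" by (rule P.group_Inn)
  let ?N = "Inn_rel P Q f" and ?C = "commutator (Inn P)" and ?s = "pt_sym P"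
  have N: "?N \<subseteq> carrier (Inn P)" by (auto simp: Inn_rel_def kernel_def)
  then have mem: "\<phi> \<in> carrier (Inn P)" if "\<phi> \<in> ?N" for \<phi> using that by blast
  have c: "?C \<phi> (?s x) \<in> carrier (Inn P)" if "x \<in> carrier P" "\<phi> \<in> ?N" for x \<phi>
    using that by (simp add: mem P.pt_sym_Inn)
  have formulas: "\<forall>x\<in>carrier P. \<forall>\<phi>\<in>?N.
      ?s (\<phi> x) = ?C \<phi> (?s x) \<otimes>\<^bsub>Inn P\<^esub> ?s x \<and>
      ?C (?s x) (?s (\<phi> x)) = inv\<^bsub>Inn P\<^esub> (?C (?C \<phi> (?s x)) (?s x))"
    using P.pt_sym_image_commutator P.commutator_pt_sym_image mem by blast
  have nil1: "nilpotent_hom 1 P Q f \<longleftrightarrow>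
      (\<forall>x\<in>carrier P. \<forall>\<phi>\<in>?N. ?C \<phi> (?s x) = \<one>\<^bsub>Inn P\<^esub>)" (is "_ \<longleftrightarrow> ?R")
  proof -
    have "nilpotent_hom 1 P Q f \<longleftrightarrow> (\<forall>\<psi>\<in>carrier (Inn P). \<forall>\<phi>\<in>?N. ?C \<psi> \<phi> = \<one>\<^bsub>Inn P\<^esub>)"
      using N by (simp add: nilpotent_hom_def I.commutator_subgroup_eq_one_iff)
    \<comment> \<open>The lower central series puts \<phi> second in the commutator, while
      \<open>?R\<close> puts it first. Commuting is symmetric and bridges the two orders.\<close>
    also have "\<dots> \<longleftrightarrow> (\<forall>\<psi>\<in>carrier (Inn P). \<forall>\<phi>\<in>?N. \<phi> \<otimes>\<^bsub>Inn P\<^esub> \<psi> = \<psi> \<otimes>\<^bsub>Inn P\<^esub> \<phi>)"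
      using mem by (intro ball_cong refl) (auto simp: I.commutator_eq_one_iff)
    also have "\<dots> \<longleftrightarrow> (\<forall>x\<in>carrier P. \<forall>\<phi>\<in>?N. \<phi> \<otimes>\<^bsub>Inn P\<^esub> ?s x = ?s x \<otimes>\<^bsub>Inn P\<^esub> \<phi>)"
      by (auto intro: P.Inn_central_if_commutes_pt_sym P.pt_sym_Inn mem)
    also have "\<dots> \<longleftrightarrow> ?R"
      using mem by (simp add: I.commutator_eq_one_iff P.pt_sym_Inn)
    finally show ?thesis .
  qed
  have red: "reduced_hom P Q f \<longleftrightarrow> (\<forall>x\<in>carrier P. \<forall>\<phi>\<in>?N. ?C \<phi> (?s x) x = x)"
    by (simp add: reduced_hom_def P.qsym_image_eq_commutator mem)
  have op: "operator_reduced_hom P Q f \<longleftrightarrow>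
      (\<forall>x\<in>carrier P. \<forall>\<phi>\<in>?N. ?C (?C \<phi> (?s x)) (?s x) = \<one>\<^bsub>Inn P\<^esub>)"
  proof -
    have "?s x \<otimes>\<^bsub>Inn P\<^esub> ?s (\<phi> x) = ?s (\<phi> x) \<otimes>\<^bsub>Inn P\<^esub> ?s x \<longleftrightarrow>
        ?C (?C \<phi> (?s x)) (?s x) = \<one>\<^bsub>Inn P\<^esub>" if "x \<in> carrier P" "\<phi> \<in> ?N" for x \<phi>
    proof -
      have "?s x \<otimes>\<^bsub>Inn P\<^esub> ?s (\<phi> x) = ?s (\<phi> x) \<otimes>\<^bsub>Inn P\<^esub> ?s x \<longleftrightarrow>
          ?C (?s x) (?s (\<phi> x)) = \<one>\<^bsub>Inn P\<^esub>"
        using that by (simp add: I.commutator_eq_one_iff P.pt_sym_Inn P.Inn_closed mem)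
      \<comment> \<open>The two commutators are inverse to each other, so they are trivial
        together.\<close>
      also have "\<dots> \<longleftrightarrow> ?C (?C \<phi> (?s x)) (?s x) = \<one>\<^bsub>Inn P\<^esub>"
        using that by (simp add: P.commutator_pt_sym_image mem c P.pt_sym_Inn)
      finally show ?thesis .
    qed
    then show ?thesis by (simp add: operator_reduced_hom_def)
  qed
  have nil1_red: "nilpotent_hom 1 P Q f \<longrightarrow> reduced_hom P Q f"
    unfolding nil1 red by (simp add: P.Inn_one)
  \<comment> \<open>\<open>P.pt_sym_commute_if_fixed\<close> is applied with y = \<phi>(x).\<close>
  have red_op: "reduced_hom P Q f \<longrightarrow> operator_reduced_hom P Q f"
    by (auto simp: reduced_hom_def operator_reduced_hom_def
        intro: P.pt_sym_commute_if_fixed P.Inn_closed mem)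
  have nil2_op: "nilpotent_hom 2 P Q f \<longrightarrow> operator_reduced_hom P Q f"
  proof
    let ?\<Gamma> = "commutator_subgroup (Inn P) (carrier (Inn P)) ?N"
    assume "nilpotent_hom 2 P Q f"
    \<comment> \<open>Here \<open>?\<Gamma>\<close> is \<Gamma>_1, and triviality of \<Gamma>_2 =
      [Inn P, \<Gamma>_1] says that each of its generators is trivial.\<close>
    then have trivial: "?C \<psi> u = \<one>\<^bsub>Inn P\<^esub>" if "\<psi> \<in> carrier (Inn P)" "u \<in> ?\<Gamma>" for \<psi> u
      using that I.commutator_subgroup_eq_one_iff[OF subset_refl I.commutator_subgroup_closed[OF subset_refl N]]
      by (simp add: nilpotent_hom_def numeral_2_eq_2)
    show "operator_reduced_hom P Q f"
      unfolding op
    proof (intro ballI)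
      fix x \<phi> assume x: "x \<in> carrier P" and \<phi>: "\<phi> \<in> ?N"
      \<comment> \<open>The generators of \<Gamma>_1 have their relative argument second, so
        [\<phi>, s_x] enters as the inverse of a generator.\<close>
      have "inv\<^bsub>Inn P\<^esub> (?C (?s x) \<phi>) \<in> ?\<Gamma>"
        using P.pt_sym_Inn[OF x] \<phi> by (auto simp: commutator_subgroup_def intro!: generate.inv)
      then have "?C \<phi> (?s x) \<in> ?\<Gamma>" using x \<phi> by (simp add: I.inv_commutator P.pt_sym_Inn mem)
      then show "?C (?C \<phi> (?s x)) (?s x) = \<one>\<^bsub>Inn P\<^esub>"
        using trivial x \<phi> c I.commutator_eq_one_commute P.pt_sym_Inn by blast
    qed
  qed
  show ?thesis
    using formulas nil1 red op nil1_red red_op nil2_op by blast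
qed

end
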